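(* For every integer $n\geq 2$ there exists an $n$-tuple $(A_1,A_2,\ldots,A_n)$ of pairwise commuting $n\times n$ real matrices, each of which is non-diagonalizable over $\mathbb{R}$, such that $(A_1,A_2,\ldots,A_n)$ is hypercyclic on $\mathbb{R}^n$.
   Context: An $m$-tuple of operators on a locally convex space $X$ is a finite sequence $(T_1,\ldots,T_m)$ of pairwise commuting continuous linear operators on $X$. The tuple is hypercyclic if there is a vector $x\in X$ such that the set $\{T_1^{k_1}T_2^{k_2}\cdots T_m^{k_m}x : k_1,\ldots,k_m\geq 0 \text{ integers}\}$ is dense in $X$. Real $n\times n$ matrices are viewed as operators on $\mathbb{R}^n$. A real matrix is diagonalizable over $\mathbb{R}$ if it is similar, via a real invertible matrix, to a real diagonal matrix. *)

theory Defs
  imports "HOL-Analysis.Analysis"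
begin

(* Neither the notion of an operator tuple nor that of hypercyclicity refers to local convexity,
   so the sort only provides the linear structure and the topology of the space. *)

definition operator_tuple :: "('a::{real_vector,topological_space} \<Rightarrow> 'a) list \<Rightarrow> bool" where
  "operator_tuple Ts \<longleftrightarrow>
     (\<forall>T\<in>set Ts. linear T \<and> continuous_on UNIV T) \<and>
     (\<forall>S\<in>set Ts. \<forall>T\<in>set Ts. S \<circ> T = T \<circ> S)"

(* For Ts = [T1, ..., Tm] and ks = [k1, ..., km] the fold is T1^k1 (T2^k2 (... (Tm^km x))). *)

definition tuple_orbit :: "('a \<Rightarrow> 'a) list \<Rightarrow> 'a \<Rightarrow> 'a set" where
  "tuple_orbit Ts x =
     {foldr (\<lambda>(T, k) y. (T ^^ k) y) (zip Ts ks) x | ks :: nat list. length ks = length Ts}"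

definition hypercyclic_tuple :: "('a::{real_vector,topological_space} \<Rightarrow> 'a) list \<Rightarrow> bool" where
  "hypercyclic_tuple Ts \<longleftrightarrow> operator_tuple Ts \<and> (\<exists>x. closure (tuple_orbit Ts x) = UNIV)"

definition diagonal_matrix :: "real ^ 'n ^ 'n \<Rightarrow> bool" where
  "diagonal_matrix D \<longleftrightarrow> (\<forall>i j. i \<noteq> j \<longrightarrow> D $ i $ j = 0)"

definition diagonalizable :: "real ^ 'n ^ 'n \<Rightarrow> bool" where
  "diagonalizable A \<longleftrightarrow>
     (\<exists>P D :: real ^ 'n ^ 'n. invertible P \<and> diagonal_matrix D \<and> A = P ** D ** matrix_inv P)"

end

theory Submission
  imports Defs
begin

text \<open>Identify \<open>\<real>\<^sup>n\<close> with the algebra \<open>\<complex> \<times> \<real>\<^sup>n\<^sup>-\<^sup>2\<close>. Multiplication by an element with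
  non-real complex coordinate is not diagonalizable over the reals, so it suffices that \<open>n\<close> such
  elements generate a dense multiplicative semigroup. Take \<open>n - 1\<close> of them to be \<open>(2\<i>, 1, \<dots>, 1)\<close> and
  \<open>(\<i>, 1, \<dots>, -2, \<dots>, 1)\<close>; the negative entry provides the signs. In logarithmic coordinates the
  quotient by these is an \<open>n\<close>-dimensional torus, and the last element,
  \<open>(16\<^sup>-\<^sup>\<alpha> cis (2\<pi>\<theta>), 16\<^sup>-\<^sup>\<beta>, \<dots>)\<close>, generates a dense semigroup there by Kronecker's theorem when
  \<open>1, \<alpha>, \<beta>, \<dots>, \<theta>\<close> are independent over the integers. As its moduli are less than 1, the
  exponents of the other generators can be chosen nonnegative.\<close>

section \<open>Simultaneous Diophantine approximation with natural numbers\<close>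

lemma countable_rat_span:
  assumes "finite (S :: real set)"
  shows "countable (module.span (\<lambda>r x. of_rat r * x) S)"
proof -
  interpret vector_space "\<lambda>r x. of_rat r * x :: real"
    by standard (simp_all add: algebra_simps of_rat_add of_rat_mult)
  have "span S \<subseteq> (\<lambda>u. \<Sum>v\<in>S. of_rat (u v) * v) ` (S \<rightarrow>\<^sub>E UNIV)"
  proof
    fix x assume "x \<in> span S"
    then obtain u where "x = (\<Sum>v\<in>S. of_rat (u v) * v)"
      using span_finite[OF assms] by auto
    then have "x = (\<Sum>v\<in>S. of_rat (restrict u S v) * v)"
      by simp
    then show "x \<in> (\<lambda>u. \<Sum>v\<in>S. of_rat (u v) * v) ` (S \<rightarrow>\<^sub>E UNIV)"
      by (rule image_eqI[where x = "restrict u S"]) simp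
  qed
  moreover have "countable (S \<rightarrow>\<^sub>E (UNIV :: rat set))"
    using assms by (intro countable_PiE) auto
  ultimately show ?thesis
    by (meson countable_image countable_subset)
qed

text \<open>The reals are uncountable, so a Hamel basis over the rationals that contains 1 is
  infinite and supplies \<open>n\<close> further elements. The 1 sits at index \<open>n\<close>,
  where Kronecker's theorem expects it.\<close>

lemma int_independent_reals:
  obtains \<theta> :: "nat \<Rightarrow> real" where "\<theta> n = 1" "inj_on \<theta> {..n}"
    "module.independent (\<lambda>r x. of_int r * x) (\<theta> ` {..n})"
proof -
  interpret Q: vector_space "\<lambda>r x. of_rat r * x :: real"
    by standard (simp_all add: algebra_simps of_rat_add of_rat_mult)
  interpret Z: Modules.module "\<lambda>r x. of_int r * x :: real"
    by standard (simp_all add: algebra_simps)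
  have "Q.independent {1}"
    using Q.dependent_single[of 1] by simp
  define B where "B = Q.extend_basis {1}"
  have B: "{1} \<subseteq> B" "Q.independent B" "Q.span B = UNIV"
    unfolding B_def using \<open>Q.independent {1}\<close>
    by (rule Q.extend_basis_superset Q.independent_extend_basis Q.span_extend_basis)+
  have "infinite B"
    using B(3) countable_rat_span[of B] uncountable_UNIV_real by auto
  then obtain S where S: "S \<subseteq> B - {1}" "finite S" "card S = n"
    using infinite_arbitrarily_large[of "B - {1}" n] by auto
  obtain h where h: "bij_betw h {..<n} S"
    using S ex_bij_betw_nat_finite[of S] by (auto simp: atLeast0LessThan)
  define \<theta> where "\<theta> = h(n := 1)"
  have hS: "h ` {..<n} = S" "inj_on h {..<n}"
    using h by (auto simp: bij_betw_def)
  have im: "\<theta> ` {..n} \<subseteq> B"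
    using hS S(1) B(1) by (force simp: \<theta>_def)
  have inj: "inj_on \<theta> {..n}"
    unfolding inj_on_def
  proof (intro ballI impI)
    fix x y assume xy: "x \<in> {..n}" "y \<in> {..n}" "\<theta> x = \<theta> y"
    have "h i \<noteq> 1" if "i < n" for i
      using that hS S(1) by blast
    with xy show "x = y"
      using inj_onD[OF hS(2), of x y] by (force simp: \<theta>_def split: if_splits)
  qed
  have "Z.independent (\<theta> ` {..n})"
  proof
    assume "Z.dependent (\<theta> ` {..n})"
    then obtain T u v where T: "finite T" "T \<subseteq> \<theta> ` {..n}" "(\<Sum>v\<in>T. of_int (u v) * v) = 0"
      "v \<in> T" "u v \<noteq> 0"
      unfolding Z.dependent_explicit by blast
    \<comment> \<open>Integer relations are rational relations, so independence over the rationals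
      applies.\<close>
    have "(\<Sum>v\<in>T. of_rat (of_int (u v)) * v) = 0"
      using T(3) by simp
    then have "(of_int (u v) :: rat) = 0"
      using Q.independentD[OF B(2) T(1), of "\<lambda>v. of_int (u v)" v] T(2,4) im by blast
    with T(5) show False by simp
  qed
  with that[of \<theta>] inj show thesis
    by (simp add: \<theta>_def)
qed

text \<open>The multiplier in the library's Kronecker theorem may be negative; adding a large common
  almost-period of the fractional parts, supplied by Dirichlet's theorem, repairs this.\<close>

lemma Kronecker_approx_ge:
  fixes \<alpha> \<theta> :: "nat \<Rightarrow> real" and K :: nat
  assumes "module.independent (\<lambda>r x. of_int r * x) (\<theta> ` {..n})"
    and "inj_on \<theta> {..n}" and "\<theta> n = 1" and "\<epsilon> > 0"
  obtains k :: nat and m :: "nat \<Rightarrow> int"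
  where "k \<ge> K" "\<And>i. i < n \<Longrightarrow> \<bar>real k * \<theta> i - of_int (m i) - \<alpha> i\<bar> < \<epsilon>"
proof -
  obtain k0 m0 where k0: "\<And>i. i < n \<Longrightarrow> \<bar>of_int k0 * \<theta> i - of_int (m0 i) - \<alpha> i\<bar> < \<epsilon> / 2"
    using Kronecker_thm_2[OF assms(1-3), of "\<epsilon> / 2" \<alpha>] assms(4) by auto
  \<comment> \<open>As \<open>q\<close> is at least 1, adding \<open>L * q\<close> lifts
    \<open>k0\<close> above \<open>K\<close>. \<open>L\<close> is fixed before \<open>N\<close>, so
    that Dirichlet's error stays below \<open>\<epsilon> / 2\<close> after multiplication by
    \<open>L\<close>.\<close>
  define L where "L = K + nat \<bar>k0\<bar> + 1"
  have "L > 0" by (simp add: L_def)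
  obtain N :: nat where N: "N > 0" "1 / N < \<epsilon> / 2 / L"
    using assms(4) \<open>L > 0\<close> real_arch_inverse[of "\<epsilon> / 2 / L"]
    by (auto simp: inverse_eq_divide)
  obtain q p where q: "0 < q" "\<And>i. i < n \<Longrightarrow> \<bar>of_int q * \<theta> i - of_int (p i)\<bar> < 1 / N"
    using Dirichlet_approx_simult[OF N(1), where n = n and \<theta> = \<theta>] by metis
  define k where "k = k0 + int L * q"
  have "int L * q \<ge> int L"
    using q(1) by (simp add: mult_le_cancel_left1)
  then have k: "k \<ge> int K"
    by (simp add: k_def L_def)
  show thesis
  proof (rule that[of "nat k" "\<lambda>i. m0 i + int L * p i"])
    show "K \<le> nat k" using k by linarith
    fix i assume i: "i < n"
    have "\<bar>real L * (of_int q * \<theta> i - of_int (p i))\<bar> < \<epsilon> / 2"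
    proof -
      have "\<bar>of_int q * \<theta> i - of_int (p i)\<bar> < \<epsilon> / 2 / L"
        using q(2)[OF i] N(2) by linarith
      then show ?thesis
        using \<open>L > 0\<close> by (simp add: abs_mult pos_less_divide_eq mult.commute)
    qed
    moreover have "real (nat k) * \<theta> i - of_int (m0 i + int L * p i) - \<alpha> i
      = (of_int k0 * \<theta> i - of_int (m0 i) - \<alpha> i) + real L * (of_int q * \<theta> i - of_int (p i))"
      using k by (simp add: k_def algebra_simps)
    ultimately show "\<bar>real (nat k) * \<theta> i - of_int (m0 i + int L * p i) - \<alpha> i\<bar> < \<epsilon>"
      using k0[OF i] by linarith
  qed
qed

text \<open>Integer shifts move the independent numbers into [1, 2) without affecting
  approximability. Then \<open>k * \<alpha> i\<close> is at least \<open>k\<close>, and a large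
  \<open>k\<close> forces the approximating integers to be nonnegative.\<close>

lemma nat_Kronecker_reals:
  obtains \<alpha> :: "'n::finite \<Rightarrow> real"
  where "\<And>\<beta> \<epsilon>. \<epsilon> > 0 \<Longrightarrow> \<exists>(k::nat) (m::'n \<Rightarrow> nat). \<forall>i. \<bar>real k * \<alpha> i - real (m i) - \<beta> i\<bar> < \<epsilon>"
proof -
  define n where "n = CARD('n)"
  obtain \<theta> :: "nat \<Rightarrow> real" where \<theta>: "\<theta> n = 1" "inj_on \<theta> {..n}"
    "module.independent (\<lambda>r x. of_int r * x) (\<theta> ` {..n})"
    by (rule int_independent_reals)
  obtain h :: "'n \<Rightarrow> nat" where h: "bij_betw h UNIV {..<n}"
    using ex_bij_betw_finite_nat[of "UNIV :: 'n set"] by (auto simp: n_def atLeast0LessThan)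
  have hn: "h i < n" and inv: "inv h (h i) = i" for i
    using h by (auto simp: bij_betw_def)
  define \<alpha> where "\<alpha> i = frac (\<theta> (h i)) + 1" for i
  have "\<exists>(k::nat) (m::'n \<Rightarrow> nat). \<forall>i. \<bar>real k * \<alpha> i - real (m i) - \<beta> i\<bar> < \<epsilon>" if eps: "\<epsilon> > 0" for \<beta> \<epsilon>
  proof -
    define K where "K = nat \<lceil>(\<Sum>i\<in>UNIV. \<bar>\<beta> i\<bar>) + \<epsilon>\<rceil>"
    have K: "real K \<ge> \<bar>\<beta> i\<bar> + \<epsilon>" for i
    proof -
      have "\<bar>\<beta> i\<bar> \<le> (\<Sum>i\<in>UNIV. \<bar>\<beta> i\<bar>)"
        by (rule member_le_sum) auto
      then show ?thesis unfolding K_def by linarith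
    qed
    obtain k :: nat and m where k: "k \<ge> K"
      "\<And>i. i < n \<Longrightarrow> \<bar>real k * \<theta> i - of_int (m i) - \<beta> (inv h i)\<bar> < \<epsilon>"
      by (rule Kronecker_approx_ge[OF \<theta>(3,2,1) eps,
            where K = K and \<alpha> = "\<lambda>j. \<beta> (inv h j)"]) (rule that)
    \<comment> \<open>The shift from \<open>\<theta> (h i)\<close> to \<open>\<alpha> i\<close>,
      taken \<open>k\<close> times, is an integer and is absorbed here.\<close>
    define m' where "m' i = m (h i) + int k - int k * \<lfloor>\<theta> (h i)\<rfloor>" for i
    have eq: "real k * \<alpha> i - of_int (m' i) - \<beta> i
        = real k * \<theta> (h i) - of_int (m (h i)) - \<beta> (inv h (h i))" for i
      by (simp add: \<alpha>_def m'_def frac_def algebra_simps inv)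
    have lt: "\<bar>real k * \<alpha> i - of_int (m' i) - \<beta> i\<bar> < \<epsilon>" for i
      unfolding eq using k(2) hn by blast
    have "m' i \<ge> 0" for i
    proof -
      have "real k * \<alpha> i \<ge> real k"
        by (simp add: \<alpha>_def mult_le_cancel_left1)
      then have "real_of_int (m' i) > 0"
        using lt[of i] K[of i] k(1) by linarith
      then show ?thesis by linarith
    qed
    then have "\<forall>i. \<bar>real k * \<alpha> i - real (nat (m' i)) - \<beta> i\<bar> < \<epsilon>"
      using lt by simp
    then show ?thesis by (intro exI[of _ k] exI[of _ "\<lambda>i. nat (m' i)"])
  qed
  then show thesis by (rule that)
qed

section \<open>Multiplication operators of the algebra\<close>

text \<open>The coordinates \<open>a\<close> and \<open>b\<close> hold the real and imaginary part of the complex factor; \<open>s\<close> and \<open>r\<close>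
  are ignored there.\<close>

definition block_vec :: "'n \<Rightarrow> 'n \<Rightarrow> complex \<Rightarrow> ('n \<Rightarrow> real) \<Rightarrow> real ^ 'n" where
  "block_vec a b w s = (\<chi> i. if i = a then Re w else if i = b then Im w else s i)"

definition block_op :: "'n \<Rightarrow> 'n \<Rightarrow> complex \<Rightarrow> ('n \<Rightarrow> real) \<Rightarrow> real ^ 'n \<Rightarrow> real ^ 'n" where
  "block_op a b z r x = block_vec a b (z * Complex (x $ a) (x $ b)) (\<lambda>i. r i * x $ i)"

lemma block_op_block_vec:
  "a \<noteq> b \<Longrightarrow> block_op a b z r (block_vec a b w s) = block_vec a b (z * w) (\<lambda>i. r i * s i)"
  by (simp add: block_op_def block_vec_def vec_eq_iff)

lemma linear_block_op: "linear (block_op a b z r :: real ^ 'n::finite \<Rightarrow> _)"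
  by (rule linearI) (simp_all add: block_op_def block_vec_def vec_eq_iff algebra_simps)

lemma matrix_block_op:
  fixes x :: "real ^ 'n::finite"
  shows "matrix (block_op a b z r) *v x = block_op a b z r x"
  by (rule matrix_works) (simp add: linear_matrix_vector_mul_eq linear_block_op)

lemma block_op_commute:
  "a \<noteq> b \<Longrightarrow> block_op a b z r \<circ> block_op a b z' r' = block_op a b z' r' \<circ> block_op a b z r"
  by (simp add: fun_eq_iff block_op_def block_vec_def vec_eq_iff algebra_simps)

lemma block_op_power:
  "a \<noteq> b \<Longrightarrow> (block_op a b z r ^^ k) (block_vec a b w s) = block_vec a b (z ^ k * w) (\<lambda>i. r i ^ k * s i)"
  by (induction k) (simp_all add: block_op_block_vec mult.assoc)

lemma foldr_block_op:
  assumes "a \<noteq> b"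
  shows "foldr (\<lambda>(T, k) y. (T ^^ k) y)
      (zip (map (\<lambda>i. block_op a b (z i) (r i)) is) (map ks is)) (block_vec a b w s)
    = block_vec a b (prod_list (map (\<lambda>i. z i ^ ks i) is) * w)
        (\<lambda>j. prod_list (map (\<lambda>i. r i j ^ ks i) is) * s j)"
  by (induction "is") (simp_all add: block_op_power[OF assms] mult.assoc)

section \<open>Non-diagonalizability over the reals\<close>

lemma matrix_inv_inverse:
  assumes "invertible P"
  shows "P ** matrix_inv P = mat 1" "matrix_inv P ** P = mat 1"
  using someI_ex[OF assms[unfolded invertible_def]] by (simp_all add: matrix_inv_def)

text \<open>The columns of a diagonalizing \<open>P\<close> would be eigenvectors with real
  eigenvalues. Since \<open>z\<close> is not real, these vanish in the complex factor, so row
  \<open>a\<close> of \<open>P\<close> is zero and \<open>P\<close> is singular.\<close>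

lemma not_diagonalizable_block_op:
  fixes a b :: "'n::finite"
  assumes "a \<noteq> b" "Im z \<noteq> 0"
  shows "\<not> diagonalizable (matrix (block_op a b z r))"
proof
  let ?A = "matrix (block_op a b z r)"
  assume "diagonalizable ?A"
  then obtain P D :: "real ^ 'n ^ 'n" where PD: "invertible P" "diagonal_matrix D"
    "?A = P ** D ** matrix_inv P"
    unfolding diagonalizable_def by blast
  have "?A ** P = P ** D"
    using PD(1) by (simp add: PD(3) matrix_mul_assoc[symmetric] matrix_inv_inverse)
  have "P $ a $ k = 0" for k
  proof -
    define p where "p = P *v axis k 1"
    define d where "d = D $ k $ k"
    have "D *v axis k 1 = d *\<^sub>R axis k 1"
      unfolding matrix_vector_mult_basis using PD(2)
      by (auto simp: vec_eq_iff column_def axis_def diagonal_matrix_def d_def)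
    then have "(P ** D) *v axis k 1 = d *\<^sub>R p"
      by (simp add: p_def matrix_vector_mult_scaleR flip: matrix_vector_mul_assoc)
    then have "?A *v p = d *\<^sub>R p"
      by (simp add: p_def matrix_vector_mul_assoc \<open>?A ** P = P ** D\<close>)
    then have "block_op a b z r p = d *\<^sub>R p"
      by (simp add: matrix_block_op)
    then have "block_op a b z r p $ a = d * p $ a" "block_op a b z r p $ b = d * p $ b"
      by simp_all
    then have "(Re z - d) * p $ a = Im z * p $ b" "(Re z - d) * p $ b = - Im z * p $ a"
      using assms(1) by (simp_all add: block_op_def block_vec_def algebra_simps)
    \<comment> \<open>The factor is the squared modulus of \<open>z - d\<close>, positive because
      \<open>d\<close> is real and \<open>z\<close> is not.\<close>
    then have "((Re z - d)\<^sup>2 + (Im z)\<^sup>2) * p $ a = 0"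
      by algebra
    then have "p $ a = 0"
      using assms(2) by (simp add: sum_power2_eq_zero_iff)
    then show ?thesis
      by (simp add: p_def matrix_vector_mult_basis column_def)
  qed
  then have "(P ** matrix_inv P) $ a $ a = 0"
    by (simp add: matrix_matrix_mult_def)
  then show False
    using PD(1) by (simp add: matrix_inv_inverse mat_def)
qed

section \<open>Density of the orbit\<close>

text \<open>Moving \<open>y\<close> along the all-ones vector by a small positive \<open>t\<close>
  makes every component nonzero, as only finitely many \<open>t\<close> are excluded. This allows
  logarithms of the components to be used.\<close>

lemma dense_nonzero_components:
  fixes S :: "(real ^ 'n::finite) set"
  assumes "\<And>y. (\<And>i. y $ i \<noteq> 0) \<Longrightarrow> y \<in> closure S"
  shows "closure S = UNIV"
proof -
  have "y \<in> closure S" for y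
  proof -
    have ev: "\<forall>\<^sub>F t in at_right 0. \<forall>i. (y + t *\<^sub>R 1) $ i \<noteq> 0"
    proof (rule eventually_all_finite)
      fix i
      have "\<forall>\<^sub>F t in at_right 0. t \<noteq> - y $ i"
        by (rule eventually_neq_at_within)
      then show "\<forall>\<^sub>F t in at_right 0. (y + t *\<^sub>R 1) $ i \<noteq> 0"
        by (rule eventually_mono) auto
    qed
    have "((\<lambda>t. y + t *\<^sub>R 1) \<longlongrightarrow> y + 0 *\<^sub>R 1) (at_right 0)"
      by (intro tendsto_intros)
    then have "((\<lambda>t. y + t *\<^sub>R 1) \<longlongrightarrow> y) (at_right 0)"
      by simp
    with ev show ?thesis
      by (intro Lim_in_closed_set[OF closed_closure]) (auto elim!: eventually_mono intro: assms)
  qed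
  then show ?thesis by blast
qed


text \<open>Exponents are multiples of 4 up to the sign corrections \<open>r\<close>, because \<open>\<i>\<^sup>4 = 1\<close> decouples the phase
  from the moduli.\<close>

lemma block_op_orbit_prod:
  fixes \<alpha> :: "'n::finite \<Rightarrow> real" and r m :: "'n \<Rightarrow> nat" and a b :: 'n and k :: nat
  defines "Z \<equiv> \<lambda>i. if i = b then of_real (exp (- (ln 16 * \<alpha> a))) * cis (2 * pi * \<alpha> b)
      else if i = a then 2 * \<i> else \<i>"
    and "R \<equiv> \<lambda>i j. if i = b then exp (- (ln 16 * \<alpha> j)) else if i = j then -2 else 1"
    and "ks \<equiv> \<lambda>i. if i = b then k else if i = a then 4 * m a else 4 * m i + r i"
  assumes "a \<noteq> b"
  shows "(\<Prod>i\<in>UNIV. Z i ^ ks i) = (\<Prod>i\<in>UNIV - {a, b}. \<i> ^ r i) *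
      of_real (exp (- (ln 16 * (k * \<alpha> a - m a)))) * cis (2 * pi * (k * \<alpha> b - m b))"
    and "\<And>j. j \<noteq> a \<Longrightarrow> j \<noteq> b \<Longrightarrow>
      (\<Prod>i\<in>UNIV. R i j ^ ks i) = (-2) ^ r j * exp (- (ln 16 * (k * \<alpha> j - m j)))"
proof -
  \<comment> \<open>The base 16 is the common value of \<open>(2 * \<i>) ^ 4\<close> and
    \<open>(-2) ^ 4\<close>.\<close>
  have exp16: "exp (ln 16 * real l) = 16 ^ l" for l
    by (metis exp_ln exp_of_nat2_mult zero_less_numeral)
  have split_exp: "exp (- (ln 16 * (k * \<alpha> j - m j))) = exp (- (ln 16 * \<alpha> j)) ^ k * 16 ^ m j" for j
    unfolding exp16[symmetric] exp_of_nat_mult[symmetric] mult_exp_exp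
    by (simp add: algebra_simps)
  \<comment> \<open>\<open>m b\<close> is not an exponent of any generator: it counts full turns,
    which \<open>cis\<close> ignores.\<close>
  have "cis (2 * pi * (k * \<alpha> b - m b)) = cis (2 * pi * \<alpha> b) ^ k"
  proof -
    have "cis (2 * pi * (k * \<alpha> b - m b)) = cis (k * (2 * pi * \<alpha> b)) / cis (2 * pi * m b)"
      by (simp add: cis_divide algebra_simps)
    then show ?thesis
      by (simp only: Complex.DeMoivre) (simp add: cis_multiple_2pi)
  qed
  moreover have "(\<Prod>i\<in>UNIV. Z i ^ ks i) = Z b ^ k * (Z a ^ (4 * m a) * (\<Prod>i\<in>UNIV - {a, b}. Z i ^ ks i))"
    using assms(4) by (simp add: prod.remove[of UNIV b] prod.remove[of "UNIV - {b}" a] ks_def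
        Diff_insert2[symmetric] insert_commute)
  moreover have "(\<Prod>i\<in>UNIV - {a, b}. Z i ^ ks i) = (\<Prod>i\<in>UNIV - {a, b}. \<i> ^ r i)"
    by (rule prod.cong) (auto simp: Z_def ks_def power_add power_mult)
  moreover have "Z a ^ (4 * m a) = 16 ^ m a"
    using assms(4) by (simp add: Z_def power_mult power_mult_distrib)
  ultimately show "(\<Prod>i\<in>UNIV. Z i ^ ks i) = (\<Prod>i\<in>UNIV - {a, b}. \<i> ^ r i) *
      of_real (exp (- (ln 16 * (k * \<alpha> a - m a)))) * cis (2 * pi * (k * \<alpha> b - m b))"
    unfolding split_exp by (simp add: Z_def power_mult_distrib)
  fix j assume j: "j \<noteq> a" "j \<noteq> b"
  \<comment> \<open>Only the generators \<open>b\<close> and \<open>j\<close> act nontrivially on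
    the real coordinate \<open>j\<close>.\<close>
  have "(\<Prod>i\<in>UNIV. R i j ^ ks i) = (\<Prod>i\<in>{b, j}. R i j ^ ks i)"
    by (rule prod.mono_neutral_right) (auto simp: R_def)
  also have "\<dots> = (-2) ^ r j * (exp (- (ln 16 * \<alpha> j)) ^ k * 16 ^ m j)"
    using j by (simp add: R_def ks_def power_add power_mult)
  finally show "(\<Prod>i\<in>UNIV. R i j ^ ks i) = (-2) ^ r j * exp (- (ln 16 * (k * \<alpha> j - m j)))"
    unfolding split_exp .
qed

section \<open>The hypercyclic tuple\<close>

theorem theorem1p1:
  assumes "CARD('n::finite) \<ge> 2"
  shows "\<exists>As :: (real ^ 'n ^ 'n) list.
           length As = CARD('n) \<and>
           (\<forall>A\<in>set As. \<forall>B\<in>set As. A ** B = B ** A) \<and>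
           (\<forall>A\<in>set As. \<not> diagonalizable A) \<and>
           hypercyclic_tuple (map (\<lambda>A. (*v) A) As)"
proof -
  have "UNIV \<noteq> {x}" for x :: 'n
  proof
    assume "UNIV = {x}"
    then have "CARD('n) = card {x}" by (rule arg_cong)
    with assms show False by simp
  qed
  then obtain a b :: 'n where ab: "a \<noteq> b"
    by (metis UNIV_eq_I singletonI)
  obtain \<alpha> :: "'n \<Rightarrow> real" where \<alpha>: "\<And>\<beta> \<epsilon>. \<epsilon> > 0 \<Longrightarrow>
      \<exists>(k::nat) (m::'n \<Rightarrow> nat). \<forall>i. \<bar>real k * \<alpha> i - real (m i) - \<beta> i\<bar> < \<epsilon>"
    using nat_Kronecker_reals by blast
  define Z where "Z = (\<lambda>i. if i = b then of_real (exp (- (ln 16 * \<alpha> a))) * cis (2 * pi * \<alpha> b)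
      else if i = a then 2 * \<i> else \<i>)"
  define R where "R = (\<lambda>i j. if i = b then exp (- (ln 16 * \<alpha> j)) else if i = j then -2 else 1 :: real)"
  define T where "T i = block_op a b (Z i) (R i)" for i
  obtain "is" :: "'n list" where is_UNIV: "set is = UNIV" "distinct is"
    using finite_distinct_list[of "UNIV :: 'n set"] by auto
  define As where "As = map (\<lambda>i. matrix (T i)) is"
  have linT: "linear (T i)" for i
    by (simp add: T_def linear_block_op)
  have AsT: "map (\<lambda>A. (*v) A) As = map T is"
    by (simp add: As_def T_def matrix_block_op fun_eq_iff)
  have commT: "T i \<circ> T j = T j \<circ> T i" for i j
    by (simp add: T_def block_op_commute[OF ab])

  \<comment> \<open>If \<open>2 * \<alpha> b\<close> were an integer, all
    \<open>k * \<alpha> b - m b\<close> would be half-integer multiples of 1 and never come within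
    1/8 of 1/4.\<close>
  have "sin (2 * pi * \<alpha> b) \<noteq> 0"
  proof
    assume "sin (2 * pi * \<alpha> b) = 0"
    then obtain z :: int where z: "2 * \<alpha> b = z"
      by (auto simp: sin_zero_iff_int2)
    obtain k :: nat and m :: "'n \<Rightarrow> nat" where "\<bar>real k * \<alpha> b - real (m b) - 1 / 4\<bar> < 1 / 8"
      using \<alpha>[of "1 / 8" "\<lambda>_. 1 / 4"] by auto
    then have "\<bar>real k * (2 * \<alpha> b) - 2 * real (m b) - 1 / 2\<bar> < 1 / 4"
      by linarith
    moreover define q where "q = int k * z - 2 * int (m b)"
    ultimately have "\<bar>of_int q - 1 / 2 :: real\<bar> < 1 / 4"
      by (simp add: z)
    then have "real_of_int q > 0" "real_of_int q < 1"
      by linarith+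
    then show False by simp
  qed
  then have "Im (Z i) \<noteq> 0" for i
    by (simp add: Z_def)
  then have nd: "\<not> diagonalizable (matrix (T i))" for i
    unfolding T_def using not_diagonalizable_block_op[OF ab] by blast

  let ?x = "block_vec a b 1 (\<lambda>_. 1)"
  have "y \<in> closure (tuple_orbit (map T is) ?x)" if y: "\<And>i. y $ i \<noteq> 0" for y
  proof -
    \<comment> \<open>One extra factor -2 gives a negative sign. The phase that it costs in the
      complex factor is collected in \<open>\<rho>\<close>, and its modulus 2 is compensated in
      \<open>\<beta>\<close>.\<close>
    define r where "r i = (if y $ i < 0 then 1 else 0 :: nat)" for i
    define \<rho> where "\<rho> = (\<Prod>i\<in>UNIV - {a, b}. \<i> ^ r i)"
    \<comment> \<open>For fixed signs, \<open>\<Phi>\<close> extends the orbit formula continuously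
      from the parameters \<open>k * \<alpha> i - m i\<close> to all real ones, so it remains to
      write \<open>y\<close> as \<open>\<Phi> \<beta>\<close> and approximate
      \<open>\<beta>\<close>.\<close>
    define \<Phi> where "\<Phi> \<gamma> = block_vec a b
        (\<rho> * of_real (exp (- (ln 16 * \<gamma> a))) * cis (2 * pi * \<gamma> b))
        (\<lambda>j. (-2) ^ r j * exp (- (ln 16 * \<gamma> j)))" for \<gamma>
    have orbit: "\<Phi> (\<lambda>i. k * \<alpha> i - m i) \<in> tuple_orbit (map T is) ?x" for k :: nat and m :: "'n \<Rightarrow> nat"
    proof -
      define ks where "ks i = (if i = b then k else if i = a then 4 * m a else 4 * m i + r i)" for i
      have "foldr (\<lambda>(T, k) y. (T ^^ k) y) (zip (map T is) (map ks is)) ?x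
          = block_vec a b (\<Prod>i\<in>UNIV. Z i ^ ks i) (\<lambda>j. \<Prod>i\<in>UNIV. R i j ^ ks i)"
        unfolding T_def foldr_block_op[OF ab] prod.distinct_set_conv_list[OF is_UNIV(2), symmetric]
        by (simp add: is_UNIV(1))
      also have "\<dots> = \<Phi> (\<lambda>i. k * \<alpha> i - m i)"
        using block_op_orbit_prod[OF ab, where \<alpha> = \<alpha> and k = k and m = m and r = r]
        by (simp add: block_vec_def \<Phi>_def vec_eq_iff Z_def R_def ks_def \<rho>_def)
      finally show ?thesis
        unfolding tuple_orbit_def by (smt (verit) length_map mem_Collect_eq)
    qed
    define w where "w = Complex (y $ a) (y $ b) / \<rho>"
    have "norm \<rho> = 1"
      by (simp add: \<rho>_def norm_power flip: prod_norm)
    then have "\<rho> \<noteq> 0" by auto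
    have "w \<noteq> 0"
      using y[of a] \<open>\<rho> \<noteq> 0\<close> by (auto simp: w_def complex_eq_iff[of "Complex _ _"])
    \<comment> \<open>The logarithmic coordinates of \<open>y\<close>: negated base-16 logarithms of
      the moduli, and the argument of \<open>w\<close> in full turns.\<close>
    define \<beta> where "\<beta> i = (if i = a then - ln (norm w) / ln 16 else if i = b then Arg w / (2 * pi)
        else - ln (y $ i / (-2) ^ r i) / ln 16)" for i
    have \<Phi>\<beta>: "\<Phi> \<beta> = y"
    proof -
      have "of_real (exp (- (ln 16 * \<beta> a))) * cis (2 * pi * \<beta> b) = w"
        using ab \<open>w \<noteq> 0\<close> rcis_cmod_Arg[of w] by (simp add: \<beta>_def rcis_def)
      then have "\<rho> * of_real (exp (- (ln 16 * \<beta> a))) * cis (2 * pi * \<beta> b) = Complex (y $ a) (y $ b)"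
        using \<open>\<rho> \<noteq> 0\<close> by (simp add: w_def mult.assoc)
      moreover have "(-2) ^ r j * exp (- (ln 16 * \<beta> j)) = y $ j" if "j \<noteq> a" "j \<noteq> b" for j
      proof -
        have "y $ j / (-2) ^ r j > 0"
          using y[of j] by (auto simp: r_def not_less le_less)
        then show ?thesis
          using that by (simp add: \<beta>_def)
      qed
      ultimately show ?thesis
        by (simp add: \<Phi>_def block_vec_def vec_eq_iff)
    qed
    have "\<exists>(k::nat) (m::'n \<Rightarrow> nat). \<forall>i. \<bar>real k * \<alpha> i - real (m i) - \<beta> i\<bar> < inverse (real (Suc N))" for N
      by (rule \<alpha>) simp
    then obtain k :: "nat \<Rightarrow> nat" and m :: "nat \<Rightarrow> 'n \<Rightarrow> nat"
      where km: "\<And>N i. \<bar>k N * \<alpha> i - m N i - \<beta> i\<bar> < inverse (real (Suc N))"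
      by metis
    have lim: "(\<lambda>N. k N * \<alpha> i - m N i) \<longlonglongrightarrow> \<beta> i" for i
      by (rule LIM_zero_cancel, rule Lim_null_comparison[OF _ LIMSEQ_inverse_real_of_nat])
        (intro always_eventually allI, simp only: real_norm_def, rule less_imp_le, rule km)
    have "(\<lambda>N. \<Phi> (\<lambda>i. k N * \<alpha> i - m N i)) \<longlonglongrightarrow> \<Phi> \<beta>"
      unfolding \<Phi>_def block_vec_def
      by (rule tendsto_vec_lambda) (auto intro!: tendsto_intros lim)
    then show ?thesis
      unfolding \<Phi>\<beta> closure_sequential
      by (intro exI[of _ "\<lambda>N. \<Phi> (\<lambda>i. k N * \<alpha> i - m N i)"]) (simp add: orbit)
  qed
  then have "closure (tuple_orbit (map T is) ?x) = UNIV"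
    by (rule dense_nonzero_components)
  then have "hypercyclic_tuple (map (\<lambda>A. (*v) A) As)"
    using linT commT
    by (auto simp: hypercyclic_tuple_def operator_tuple_def AsT linear_continuous_on linear_linear)
  moreover have "length As = CARD('n)"
    using distinct_card[OF is_UNIV(2)] by (simp add: As_def is_UNIV(1))
  moreover have "matrix (T i) ** matrix (T j) = matrix (T j) ** matrix (T i)" for i j
    by (metis matrix_compose[OF linT linT] commT)
  ultimately show ?thesis
    using nd by (intro exI[of _ As]) (auto simp: As_def)
qed

end
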